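(* Let $V$ be a finite-dimensional real vector space equipped with a norm $\|\cdot\|$, with dual space $V^*$ and dual norm $\|\cdot\|_*$. Suppose $K\subseteq V$ is a non-empty bounded closed convex subset. Suppose $f:K\to\mathbb{R}$ is a non-negative lower semi-continuous function that is $1$-strongly convex with respect to $\|\cdot\|$ and is bounded from above. Then the regret of the AdaFTRL algorithm with regularizer $$R(w)=\frac{f(w)}{16\cdot\sup_{v\in K}f(v)}$$ after $T$ rounds, on any sequence of loss vectors $\ell_1,\ell_2,\dots,\ell_T\in V^*$, satisfies $$\mathrm{Regret}_T\le5.3\sqrt{\sup_{v\in K}f(v)\;\sum_{t=1}^T\|\ell_t\|_*^2}.$$
   Context: Online linear optimization: in each round $t=1,2,\dots$ an algorithm chooses $w_t\in K$ and then observes a loss vector $\ell_t\in V^*$. The regret is $\mathrm{Regret}_T=\sup_{u\in K}\left(\sum_{t=1}^T\langle \ell_t,w_t\rangle-\sum_{t=1}^T\langle \ell_t,u\rangle\right)$, where $\langle\cdot,\cdot\rangle:V^*\times V\to\mathbb{R}$ is the bilinear pairing of $V^*$ and $V$. Strong convexity: for $\lambda>0$, a function $f:K\to\mathbb{R}$ is $\lambda$-strongly convex with respect to $\|\cdot\|$ if and only if, for all $x,y\in K$, $f(y)\ge f(x)+\langle\nabla f(x),y-x\rangle+\frac{\lambda}{2}\|x-y\|^2$, where $\nabla f(x)$ is any subgradient of $f$ at $x$. Fenchel conjugate: $R^*(\ell)=\sup_{w\in K}(\langle \ell,w\rangle-R(w))$ for $\ell\in V^*$; for strongly convex lower semi-continuous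 $R$ it is finite and differentiable everywhere, with $\nabla R^*(\ell)=\arg\min_{w\in K}(R(w)-\langle \ell,w\rangle)$. Bregman divergence: $\mathcal{B}_{R^*}(x,y)=R^*(x)-R^*(y)-\langle x-y,\nabla R^*(y)\rangle$. AdaFTRL with regularizer $R$: let $L_0=0$ and $L_t=L_{t-1}+\ell_t$. For $t\ge0$ let $$\Delta_t=\sum_{i=1}^t \Delta_{i-1}\,\mathcal{B}_{R^*}\!\left(-\frac{L_i}{\Delta_{i-1}},-\frac{L_{i-1}}{\Delta_{i-1}}\right)$$ (so $\Delta_0=0$), where, if $\Delta_{i-1}=0$, the $i$-th summand is defined as $\lim_{a\to0^+}a\,\mathcal{B}_{R^*}(-L_i/a,-L_{i-1}/a)$ (this limit exists and is finite). In round $t$ the algorithm predicts $w_t=\arg\min_{w\in K}\left(\langle L_{t-1},w\rangle+\Delta_{t-1}R(w)\right)$; when $\Delta_{t-1}=0$, $w_t$ is the minimizer of $\langle L_{t-1},w\rangle$ over $w\in K$ having the smallest value of $R(w)$ (unique by strong convexity), which is the same as $w_t=\lim_{a\to0^+}\arg\min_{w\in K}(\langle L_{t-1},w\rangle+aR(w))$. *)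

theory Defs
  imports "HOL-Analysis.Analysis"
begin

text \<open>
  The dual space \<open>V\<^sup>*\<close> is the type \<^typ>\<open>'v \<Rightarrow>\<^sub>L real\<close> of bounded linear functionals, whose
  norm is the operator norm, i.e. the dual norm. If \<open>'v\<close> is finite-dimensional, every linear
  functional is bounded, so this is the full algebraic dual.
\<close>

definition lower_semicontinuous_on :: "'v::topological_space set \<Rightarrow> ('v \<Rightarrow> real) \<Rightarrow> bool" where
  "lower_semicontinuous_on K f \<longleftrightarrow>
     (\<forall>x\<in>K. \<forall>c<f x. eventually (\<lambda>y. c < f y) (at x within K))"

definition is_subgradient ::
    "'v::real_normed_vector set \<Rightarrow> ('v \<Rightarrow> real) \<Rightarrow> 'v \<Rightarrow> ('v \<Rightarrow>\<^sub>L real) \<Rightarrow> bool" where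
  "is_subgradient K f x g \<longleftrightarrow> (\<forall>y\<in>K. f y \<ge> f x + g (y - x))"

text \<open>
  The inequality is required for every subgradient of \<open>f\<close> at \<open>x\<close> (relative to \<open>K\<close>); points at
  which \<open>f\<close> has no subgradient impose no condition.
\<close>

definition strongly_convex_on ::
    "real \<Rightarrow> 'v::real_normed_vector set \<Rightarrow> ('v \<Rightarrow> real) \<Rightarrow> bool" where
  "strongly_convex_on \<mu> K f \<longleftrightarrow>
     (\<forall>x\<in>K. \<forall>y\<in>K. \<forall>g. is_subgradient K f x g \<longrightarrow>
        f y \<ge> f x + g (y - x) + \<mu> / 2 * (norm (x - y))\<^sup>2)"

definition fenchel_conj ::
    "'v::real_normed_vector set \<Rightarrow> ('v \<Rightarrow> real) \<Rightarrow> ('v \<Rightarrow>\<^sub>L real) \<Rightarrow> real" where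
  "fenchel_conj K R l = (SUP w\<in>K. blinfun_apply l w - R w)"

text \<open>
  The pairing \<open>\<langle>x - y, \<nabla>F(y)\<rangle>\<close> is by definition of the gradient the value of the derivative
  of \<open>F\<close> at \<open>y\<close> in the direction \<open>x - y\<close>.
\<close>

definition bregman :: "('a::real_normed_vector \<Rightarrow> real) \<Rightarrow> 'a \<Rightarrow> 'a \<Rightarrow> real" where
  "bregman F x y = F x - F y - frechet_derivative F (at y) (x - y)"

definition cum_loss :: "(nat \<Rightarrow> 'v::real_normed_vector \<Rightarrow>\<^sub>L real) \<Rightarrow> nat \<Rightarrow> 'v \<Rightarrow>\<^sub>L real" where
  "cum_loss l t = (\<Sum>i=1..t. l i)"

text \<open>
  \<open>scaled_bregman F d L' L\<close> is \<open>d * B\<^sub>F(-L'/d, -L/d)\<close>, extended to \<open>d = 0\<close> by its limit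
  as \<open>d\<close> tends to \<open>0\<close> from the right.
\<close>

definition scaled_bregman ::
    "('a::real_normed_vector \<Rightarrow> real) \<Rightarrow> real \<Rightarrow> 'a \<Rightarrow> 'a \<Rightarrow> real" where
  "scaled_bregman F d L' L =
     (if d = 0 then Lim (at_right 0) (\<lambda>a. a * bregman F (- (L' /\<^sub>R a)) (- (L /\<^sub>R a)))
      else d * bregman F (- (L' /\<^sub>R d)) (- (L /\<^sub>R d)))"

fun adaftrl_Delta ::
    "'v::real_normed_vector set \<Rightarrow> ('v \<Rightarrow> real) \<Rightarrow> (nat \<Rightarrow> 'v \<Rightarrow>\<^sub>L real) \<Rightarrow> nat \<Rightarrow> real" where
  "adaftrl_Delta K R l t =
     (\<Sum>i\<in>{1..t}. scaled_bregman (fenchel_conj K R) (adaftrl_Delta K R l (i - 1))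
        (cum_loss l i) (cum_loss l (i - 1)))"

declare adaftrl_Delta.simps [simp del]

text \<open>
  The prediction \<open>w\<^sub>t\<close> for round \<open>t \<ge> 1\<close>. When \<open>\<Delta>\<^sub>t\<^sub>-\<^sub>1 = 0\<close>, ties between the minimizers of
  \<open>L\<^sub>t\<^sub>-\<^sub>1\<close> over \<open>K\<close> are broken by the smallest value of \<open>R\<close>.
\<close>

definition adaftrl ::
    "'v::real_normed_vector set \<Rightarrow> ('v \<Rightarrow> real) \<Rightarrow> (nat \<Rightarrow> 'v \<Rightarrow>\<^sub>L real) \<Rightarrow> nat \<Rightarrow> 'v" where
  "adaftrl K R l t =
     (let L = cum_loss l (t - 1); d = adaftrl_Delta K R l (t - 1)
      in if d = 0 then arg_min_on R {w. is_arg_min (blinfun_apply L) (\<lambda>w. w \<in> K) w}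
         else arg_min_on (\<lambda>w. L w + d * R w) K)"

definition regret ::
    "'v::real_normed_vector set \<Rightarrow> (nat \<Rightarrow> 'v \<Rightarrow>\<^sub>L real) \<Rightarrow> (nat \<Rightarrow> 'v) \<Rightarrow> nat \<Rightarrow> real" where
  "regret K l w T = (SUP u\<in>K. (\<Sum>t=1..T. blinfun_apply (l t) (w t)) - (\<Sum>t=1..T. blinfun_apply (l t) u))"

end

theory Submission
  imports Defs
begin

text \<open>
  Write \<open>w\<^sub>d(L)\<close> for the minimizer of \<open>L + d R\<close> over \<open>K\<close>. Since \<open>\<nabla>R\<^sup>*(-L/d) = w\<^sub>d(L)\<close>, the scaled
  Bregman divergence \<open>d * B(-L'/d, -L/d)\<close> is the suboptimality of \<open>w\<^sub>d(L)\<close> for the objective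
  \<open>L' + d R\<close>; this persists for \<open>d = 0\<close> because \<open>w\<^sub>a(L)\<close> tends to \<open>w\<^sub>0(L)\<close>. Telescoping gives
  regret at most \<open>(1 + R(u)) \<Delta>\<^sub>T\<close>. If \<open>K\<close> has diameter at most \<open>D\<close> and \<open>R\<close> is \<open>\<mu>\<close>-strongly convex,
  the increment \<open>\<delta>\<close> of \<open>\<Delta>\<close> in round \<open>t\<close> satisfies \<open>\<delta> \<le> D \<parallel>l\<^sub>t\<parallel>\<close> and
  \<open>2 \<Delta> \<delta> \<le> \<parallel>l\<^sub>t\<parallel>\<^sup>2 / \<mu>\<close>, so \<open>\<Delta>\<^sup>2\<close> grows by at most \<open>(D\<^sup>2 + 1/\<mu>) \<parallel>l\<^sub>t\<parallel>\<^sup>2\<close>. With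
  \<open>S = sup f\<close>, growth away from the minimizer of \<open>f\<close> gives \<open>D\<^sup>2 \<le> 8 S\<close>, while \<open>\<mu> = 1/(16 S)\<close> and
  \<open>R \<le> 1/16\<close>; the resulting constant is \<open>(17/16) * sqrt 24 < 5.3\<close>.
\<close>

subsection \<open>Compactness in finite-dimensional normed spaces\<close>

text \<open>Tychonoff's theorem: the topology on functions is the product topology and each factor
  is a compact interval.\<close>

lemma compact_functions_box:
  fixes a b :: "'i \<Rightarrow> real"
  shows "compact {c. \<forall>i. a i \<le> c i \<and> c i \<le> b i}"
proof -
  have "compactin (product_topology (\<lambda>i. euclidean) UNIV) (PiE UNIV (\<lambda>i. {a i..b i}))"
    unfolding compactin_PiE by auto
  moreover have "PiE UNIV (\<lambda>i. {a i..b i}) = {c. \<forall>i. a i \<le> c i \<and> c i \<le> b i}"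
    by (auto simp: PiE_def Pi_def)
  ultimately show ?thesis by (simp add: euclidean_product_topology)
qed

lemma continuous_on_coordinate_combination:
  fixes B :: "'v::real_normed_vector set" and S :: "('v \<Rightarrow> real) set"
  shows "continuous_on S (\<lambda>c. \<Sum>b\<in>B. c b *\<^sub>R b)"
  by (intro continuous_intros continuous_on_subset[OF continuous_on_product_coordinates]) auto

text \<open>The coefficient functions supported on \<open>B\<close> with l1 norm 1 form a compact
  set, on which independence keeps the combination away from 0. So its norm has a positive minimum,
  and scaling extends the bound to all coefficients.\<close>

lemma independent_coordinates_bounded:
  fixes B :: "'v::real_normed_vector set"
  assumes "finite B" "independent B"
  obtains m where "m > 0"
    "\<And>c. m * (\<Sum>b\<in>B. \<bar>c b\<bar>) \<le> norm (\<Sum>b\<in>B. c b *\<^sub>R b)"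
proof -
  define S :: "('v \<Rightarrow> real) set" where
    "S = {c. \<forall>b. (if b \<in> B then -1 else 0) \<le> c b \<and> c b \<le> (if b \<in> B then 1 else 0)}
       \<inter> {c. (\<Sum>b\<in>B. \<bar>c b\<bar>) = 1}"
  have "closed {c :: 'v \<Rightarrow> real. (\<Sum>b\<in>B. \<bar>c b\<bar>) = 1}"
    by (intro closed_Collect_eq continuous_intros continuous_on_product_coordinates)
  then have "compact S"
    unfolding S_def by (intro compact_Int_closed compact_functions_box)
  have nz: "(\<Sum>b\<in>B. c b *\<^sub>R b) \<noteq> 0" if "c \<in> S" for c
  proof
    assume "(\<Sum>b\<in>B. c b *\<^sub>R b) = 0"
    then have "\<forall>b\<in>B. c b = 0"
      using independentD[OF assms(2,1) order_refl] by blast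
    then show False using that by (simp add: S_def)
  qed
  obtain m where m: "m > 0" "\<And>c. c \<in> S \<Longrightarrow> m \<le> norm (\<Sum>b\<in>B. c b *\<^sub>R b)"
  proof (cases "S = {}")
    case True
    then show ?thesis using that[of 1] by auto
  next
    case False
    obtain c0 where "c0 \<in> S" "\<forall>c\<in>S. norm (\<Sum>b\<in>B. c0 b *\<^sub>R b) \<le> norm (\<Sum>b\<in>B. c b *\<^sub>R b)"
      using continuous_attains_inf[OF \<open>compact S\<close> False
          continuous_on_norm[OF continuous_on_coordinate_combination]] by blast
    then show ?thesis using that nz by (metis zero_less_norm_iff)
  qed
  show ?thesis
  proof (rule that[OF m(1)])
    fix c :: "'v \<Rightarrow> real"
    define s where "s = (\<Sum>b\<in>B. \<bar>c b\<bar>)"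
    show "m * (\<Sum>b\<in>B. \<bar>c b\<bar>) \<le> norm (\<Sum>b\<in>B. c b *\<^sub>R b)"
    proof (cases "s = 0")
      case True
      then show ?thesis by (simp add: s_def)
    next
      case False
      then have "s > 0" by (metis s_def sum_nonneg abs_ge_zero less_eq_real_def)
      define c' where "c' b = (if b \<in> B then c b / s else 0)" for b
      have le: "\<bar>c b\<bar> \<le> s" if "b \<in> B" for b
        unfolding s_def by (rule member_le_sum) (use assms that in auto)
      have "(\<Sum>b\<in>B. \<bar>c' b\<bar>) = (\<Sum>b\<in>B. \<bar>c b\<bar> / s)"
        using \<open>s > 0\<close> by (simp add: c'_def)
      also have "\<dots> = 1"
        using \<open>s > 0\<close> by (simp add: s_def flip: sum_divide_distrib)
      finally have "c' \<in> S"
        using \<open>s > 0\<close> le by (fastforce simp: S_def c'_def field_simps abs_le_iff)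
      then have "m \<le> norm (\<Sum>b\<in>B. c' b *\<^sub>R b)" by (rule m(2))
      also have "(\<Sum>b\<in>B. c' b *\<^sub>R b) = (1 / s) *\<^sub>R (\<Sum>b\<in>B. c b *\<^sub>R b)"
        by (simp add: c'_def scaleR_sum_right)
      finally show ?thesis using \<open>s > 0\<close> by (simp add: s_def[symmetric] field_simps)
    qed
  qed
qed

text \<open>In coordinates of a finite basis, bounded sets have bounded coefficients, so
  \<open>K\<close> is a closed subset of the continuous image of a compact box.\<close>

lemma finite_span_closed_bounded_imp_compact:
  fixes K :: "'v::real_normed_vector set"
  assumes "\<exists>B::'v set. finite B \<and> span B = UNIV" "bounded K" "closed K"
  shows "compact K"
proof -
  obtain B0 :: "'v set" where B0: "finite B0" "span B0 = UNIV"
    using assms(1) by blast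
  obtain B where B: "B \<subseteq> B0" "independent B" "B0 \<subseteq> span B"
    using maximal_independent_subset by blast
  have "finite B" using B B0 finite_subset by blast
  have span: "span B = UNIV"
    using B(3) B0(2) by (metis span_mono span_span top.extremum_uniqueI)
  obtain m where m: "m > 0" "\<And>c. m * (\<Sum>b\<in>B. \<bar>c b\<bar>) \<le> norm (\<Sum>b\<in>B. c b *\<^sub>R b)"
    using independent_coordinates_bounded[OF \<open>finite B\<close> B(2)] by blast
  obtain C where C: "\<And>x. x \<in> K \<Longrightarrow> norm x \<le> C"
    using assms(2) by (auto simp: bounded_iff)
  \<comment> \<open>If \<open>x\<close> in \<open>K\<close> has coefficients \<open>c\<close>, then
    \<open>m\<close> times their l1 norm is at most \<open>norm x\<close>, hence at most
    \<open>C\<close>.\<close>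
  define M where "M = C / m"
  define box :: "('v \<Rightarrow> real) set" where "box = {c. \<forall>b. - M \<le> c b \<and> c b \<le> M}"
  define \<Phi> where "\<Phi> c = (\<Sum>b\<in>B. c b *\<^sub>R b)" for c :: "'v \<Rightarrow> real"
  have "compact (\<Phi> ` box)"
    unfolding box_def \<Phi>_def
    by (rule compact_continuous_image[OF continuous_on_coordinate_combination compact_functions_box])
  moreover have "K \<subseteq> \<Phi> ` box"
  proof
    fix x assume "x \<in> K"
    have "x \<in> span B" using span by simp
    then obtain u where u: "x = (\<Sum>b\<in>B. u b *\<^sub>R b)"
      using span_finite[OF \<open>finite B\<close>] by auto
    define c where "c b = (if b \<in> B then u b else 0)" for b
    have "\<Phi> c = x" by (simp add: \<Phi>_def c_def u)
    have s: "(\<Sum>b\<in>B. \<bar>c b\<bar>) \<le> M"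
      using m(2)[of c] C[OF \<open>x \<in> K\<close>] \<open>\<Phi> c = x\<close> \<open>m > 0\<close>
      by (simp add: M_def \<Phi>_def field_simps)
    have "0 \<le> M" using s by (meson abs_ge_zero order_trans sum_nonneg)
    have "\<bar>c b\<bar> \<le> M" for b
    proof (cases "b \<in> B")
      case True
      then have "\<bar>c b\<bar> \<le> (\<Sum>b\<in>B. \<bar>c b\<bar>)"
        by (intro member_le_sum) (use \<open>finite B\<close> in auto)
      with s show ?thesis by simp
    qed (simp add: c_def \<open>0 \<le> M\<close>)
    then have "c \<in> box" by (auto simp: box_def abs_le_iff minus_le_iff)
    then show "x \<in> \<Phi> ` box" using \<open>\<Phi> c = x\<close> by blast
  qed
  ultimately show ?thesis
    using assms(3) by (metis compact_Int_closed inf.absorb2)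
qed

subsection \<open>Lower semicontinuity\<close>

lemma lower_semicontinuous_on_subset:
  "lower_semicontinuous_on K f \<Longrightarrow> S \<subseteq> K \<Longrightarrow> lower_semicontinuous_on S f"
  unfolding lower_semicontinuous_on_def by (meson at_le filter_leD subsetD)

lemma lower_semicontinuous_on_add:
  fixes f g :: "'v::topological_space \<Rightarrow> real"
  assumes "lower_semicontinuous_on K f" "lower_semicontinuous_on K g"
  shows "lower_semicontinuous_on K (\<lambda>x. f x + g x)"
  unfolding lower_semicontinuous_on_def
proof (intro ballI allI impI)
  fix x c assume x: "x \<in> K" and c: "c < f x + g x"
  define e where "e = (f x + g x - c) / 2"
  have e: "e > 0" using c by (simp add: e_def)
  have "eventually (\<lambda>y. f x - e < f y) (at x within K)"
       "eventually (\<lambda>y. g x - e < g y) (at x within K)"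
    using assms x e by (auto simp: lower_semicontinuous_on_def)
  then show "eventually (\<lambda>y. c < f y + g y) (at x within K)"
    by eventually_elim (simp add: e_def field_simps)
qed

lemma lower_semicontinuous_on_cmult:
  fixes f :: "'v::topological_space \<Rightarrow> real"
  assumes "lower_semicontinuous_on K f" "0 \<le> d"
  shows "lower_semicontinuous_on K (\<lambda>x. d * f x)"
proof (cases "d = 0")
  case False
  then have "d > 0" using assms by simp
  show ?thesis
    unfolding lower_semicontinuous_on_def
  proof (intro ballI allI impI)
    fix x c assume x: "x \<in> K" and c: "c < d * f x"
    have "c / d < f x" using c \<open>d > 0\<close> by (simp add: pos_divide_less_eq mult.commute)
    then have "eventually (\<lambda>y. c / d < f y) (at x within K)"
      using assms(1) x unfolding lower_semicontinuous_on_def by blast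
    then show "eventually (\<lambda>y. c < d * f y) (at x within K)"
      by eventually_elim (use \<open>d > 0\<close> in \<open>simp add: field_simps\<close>)
  qed
qed (simp add: lower_semicontinuous_on_def)

lemma continuous_on_imp_lower_semicontinuous_on:
  "continuous_on K f \<Longrightarrow> lower_semicontinuous_on K f"
  by (auto simp: lower_semicontinuous_on_def continuous_on_def intro: order_tendstoD)

lemma lower_semicontinuous_on_openin_superlevel:
  assumes "lower_semicontinuous_on K f"
  shows "openin (top_of_set K) {x\<in>K. c < f x}"
proof (subst openin_subopen, intro ballI)
  fix x assume x: "x \<in> {x\<in>K. c < f x}"
  then have "eventually (\<lambda>y. c < f y) (at x within K)"
    using assms by (auto simp: lower_semicontinuous_on_def)
  then obtain U where U: "open U" "x \<in> U" "\<forall>y\<in>U. y \<noteq> x \<longrightarrow> y \<in> K \<longrightarrow> c < f y"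
    unfolding eventually_at_topological by blast
  then have "openin (top_of_set K) (K \<inter> U)" by (simp add: openin_open_Int)
  then show "\<exists>T. openin (top_of_set K) T \<and> x \<in> T \<and> T \<subseteq> {x\<in>K. c < f x}"
    using U x by (intro exI[of _ "K \<inter> U"]) auto
qed

lemma lower_semicontinuous_on_compact_sublevel:
  assumes "lower_semicontinuous_on K f" "compact K"
  shows "compact {x\<in>K. f x \<le> c}"
proof -
  have "{x\<in>K. f x \<le> c} = K - {x\<in>K. c < f x}" by auto
  moreover have "closedin (top_of_set K) (K - {x\<in>K. c < f x})"
    using lower_semicontinuous_on_openin_superlevel[OF assms(1), of c]
    by (metis closedin_diff closedin_topspace topspace_euclidean_subtopology)
  ultimately show ?thesis using assms(2) closedin_compact by metis
qed

text \<open>Without a minimizer, the relatively open sets where \<open>f\<close> exceeds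
  \<open>f y\<close>, for \<open>y\<close> in \<open>K\<close>, cover \<open>K\<close>. In a finite
  subcover, the index with least value of \<open>f\<close> is itself left uncovered.\<close>

lemma lower_semicontinuous_on_attains_inf:
  assumes "lower_semicontinuous_on K f" "compact K" "K \<noteq> {}"
  obtains x where "x \<in> K" "\<And>y. y \<in> K \<Longrightarrow> f x \<le> f y"
proof -
  have "\<exists>x\<in>K. \<forall>y\<in>K. f x \<le> f y"
  proof (rule ccontr)
    assume "\<not> ?thesis"
    then have "K \<subseteq> (\<Union>y\<in>K. {x\<in>K. f y < f x})" by (auto simp: not_le)
    moreover have "\<forall>U\<in>(\<lambda>y. {x\<in>K. f y < f x}) ` K. openin (top_of_set K) U"
      using lower_semicontinuous_on_openin_superlevel[OF assms(1)] by blast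
    ultimately obtain D where D: "D \<subseteq> (\<lambda>y. {x\<in>K. f y < f x}) ` K" "finite D" "K \<subseteq> \<Union>D"
      using assms(2)[unfolded compact_eq_openin_cover, rule_format,
          of "(\<lambda>y. {x\<in>K. f y < f x}) ` K"] by blast
    obtain Y where Y: "Y \<subseteq> K" "finite Y" "D = (\<lambda>y. {x\<in>K. f y < f x}) ` Y"
      using finite_subset_image[OF D(2,1)] by blast
    have "Y \<noteq> {}" using Y D assms(3) by auto
    define y where "y = arg_min_on f Y"
    have y: "y \<in> Y" "\<And>z. z \<in> Y \<Longrightarrow> f y \<le> f z"
      using arg_min_if_finite(1)[OF Y(2) \<open>Y \<noteq> {}\<close>, of f] arg_min_least[OF Y(2) \<open>Y \<noteq> {}\<close>, of _ f]
      by (auto simp: y_def)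
    then obtain z where "z \<in> Y" "f z < f y" using Y D by blast
    then show False using y(2)[of z] by simp
  qed
  then show ?thesis using that by blast
qed

subsection \<open>Regularized minimizers\<close>

text \<open>The prediction rule of \<open>adaftrl\<close> with weight and cumulative loss as free
  arguments, so that minimizers for different weights and losses can be compared.\<close>

definition ftrl_min ::
    "'v::real_normed_vector set \<Rightarrow> ('v \<Rightarrow> real) \<Rightarrow> real \<Rightarrow> ('v \<Rightarrow>\<^sub>L real) \<Rightarrow> 'v" where
  "ftrl_min K R d L =
     (if d = 0 then arg_min_on R {w. is_arg_min (blinfun_apply L) (\<lambda>w. w \<in> K) w}
      else arg_min_on (\<lambda>w. L w + d * R w) K)"

lemma lower_semicontinuous_on_arg_min_on:
  assumes "lower_semicontinuous_on K f" "compact K" "K \<noteq> {}"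
  shows "arg_min_on f K \<in> K" "\<And>y. y \<in> K \<Longrightarrow> f (arg_min_on f K) \<le> f y"
proof -
  obtain x where "x \<in> K" "\<And>y. y \<in> K \<Longrightarrow> f x \<le> f y"
    using lower_semicontinuous_on_attains_inf[OF assms] by blast
  then have "is_arg_min f (\<lambda>x. x \<in> K) x"
    by (force simp: is_arg_min_def)
  then have "is_arg_min f (\<lambda>x. x \<in> K) (arg_min_on f K)"
    unfolding arg_min_on_def arg_min_def by (rule someI)
  then show "arg_min_on f K \<in> K" "\<And>y. y \<in> K \<Longrightarrow> f (arg_min_on f K) \<le> f y"
    by (auto simp: is_arg_min_def not_less)
qed

locale ftrl_regularizer =
  fixes K :: "'v::real_normed_vector set" and R :: "'v \<Rightarrow> real" and \<mu> :: real
  assumes K_compact: "compact K" and K_nonempty: "K \<noteq> {}"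
    and R_nonneg: "\<And>w. w \<in> K \<Longrightarrow> 0 \<le> R w"
    and R_lsc: "lower_semicontinuous_on K R"
    and R_strong: "strongly_convex_on \<mu> K R" and \<mu>_pos: "0 < \<mu>"
begin

lemma penalized_lsc:
  fixes L :: "'v \<Rightarrow>\<^sub>L real"
  assumes "0 \<le> d"
  shows "lower_semicontinuous_on K (\<lambda>w. L w + d * R w)"
  by (intro lower_semicontinuous_on_add lower_semicontinuous_on_cmult[OF R_lsc assms]
      continuous_on_imp_lower_semicontinuous_on[of K "blinfun_apply L"] continuous_intros)

text \<open>The minimizers of \<open>L\<close> form a compact sublevel set of \<open>L\<close>, on
  which the lower semicontinuous \<open>R\<close> attains its minimum; the third claim is the
  tie-breaking rule.\<close>

lemma ftrl_min_zero:
  fixes L :: "'v \<Rightarrow>\<^sub>L real"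
  shows "ftrl_min K R 0 L \<in> K"
    and "\<And>y. y \<in> K \<Longrightarrow> L (ftrl_min K R 0 L) \<le> L y"
    and "\<And>y. y \<in> K \<Longrightarrow> L y \<le> L (ftrl_min K R 0 L) \<Longrightarrow> R (ftrl_min K R 0 L) \<le> R y"
proof -
  define F where "F = {w. is_arg_min (blinfun_apply L) (\<lambda>w. w \<in> K) w}"
  have lsc: "lower_semicontinuous_on K (blinfun_apply L)"
    using penalized_lsc[of 0 L] by simp
  obtain w0 where w0: "w0 \<in> K" "\<And>y. y \<in> K \<Longrightarrow> L w0 \<le> L y"
    using lower_semicontinuous_on_attains_inf[OF lsc K_compact K_nonempty] by blast
  have F: "F = {w\<in>K. L w \<le> L w0}"
    using w0 by (force simp: F_def is_arg_min_def)
  have "compact F" "F \<noteq> {}" "lower_semicontinuous_on F R"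
    using lower_semicontinuous_on_compact_sublevel[OF lsc K_compact] w0
      lower_semicontinuous_on_subset[OF R_lsc, of F] by (auto simp: F)
  note * = lower_semicontinuous_on_arg_min_on[OF this(3,1,2)]
  have W: "ftrl_min K R 0 L = arg_min_on R F"
    by (simp add: ftrl_min_def F_def)
  show "ftrl_min K R 0 L \<in> K"
    and "\<And>y. y \<in> K \<Longrightarrow> L (ftrl_min K R 0 L) \<le> L y"
    and "\<And>y. y \<in> K \<Longrightarrow> L y \<le> L (ftrl_min K R 0 L) \<Longrightarrow> R (ftrl_min K R 0 L) \<le> R y"
    using * w0 unfolding W F by force+
qed

lemma ftrl_min_optimal:
  fixes L :: "'v \<Rightarrow>\<^sub>L real"
  assumes "0 \<le> d"
  shows "ftrl_min K R d L \<in> K"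
    and "\<And>y. y \<in> K \<Longrightarrow>
      L (ftrl_min K R d L) + d * R (ftrl_min K R d L) \<le> L y + d * R y"
proof -
  have "ftrl_min K R d L \<in> K \<and>
      (\<forall>y\<in>K. L (ftrl_min K R d L) + d * R (ftrl_min K R d L) \<le> L y + d * R y)"
  proof (cases "d = 0")
    case True
    then show ?thesis using ftrl_min_zero by simp
  next
    case False
    then have "ftrl_min K R d L = arg_min_on (\<lambda>w. L w + d * R w) K"
      by (simp add: ftrl_min_def)
    then show ?thesis
      using lower_semicontinuous_on_arg_min_on[OF penalized_lsc[OF assms, of L] K_compact K_nonempty]
      by simp
  qed
  then show "ftrl_min K R d L \<in> K"
    and "\<And>y. y \<in> K \<Longrightarrow>
      L (ftrl_min K R d L) + d * R (ftrl_min K R d L) \<le> L y + d * R y"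
    by blast+
qed

text \<open>If \<open>w\<close> maximizes \<open>\<theta> - R\<close>, then \<open>\<theta>\<close> is itself a subgradient of \<open>R\<close> at \<open>w\<close>, so strong
  convexity applies at \<open>w\<close> even though \<open>R\<close> is not assumed to be convex.\<close>

lemma quadratic_growth:
  fixes \<theta> :: "'v \<Rightarrow>\<^sub>L real"
  assumes "w \<in> K" "\<And>y. y \<in> K \<Longrightarrow> \<theta> y - R y \<le> \<theta> w - R w" "y \<in> K"
  shows "\<theta> y - R y + \<mu> / 2 * (norm (y - w))\<^sup>2 \<le> \<theta> w - R w"
proof -
  have "is_subgradient K R w \<theta>"
    using assms(2) by (force simp: is_subgradient_def blinfun.diff_right)
  then have "R y \<ge> R w + \<theta> (y - w) + \<mu> / 2 * (norm (w - y))\<^sup>2"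
    using R_strong assms by (auto simp: strongly_convex_on_def)
  then show ?thesis by (simp add: blinfun.diff_right norm_minus_commute)
qed

lemma blinfun_apply_scaled:
  "blinfun_apply (- (L /\<^sub>R d)) w = - (blinfun_apply L w / d)"
  by (simp add: blinfun.minus_left blinfun.scaleR_left divide_inverse_commute)

lemma ftrl_min_maximizes_dual:
  fixes L :: "'v \<Rightarrow>\<^sub>L real"
  assumes "0 < d" "y \<in> K"
  shows "blinfun_apply (- (L /\<^sub>R d)) y - R y
    \<le> blinfun_apply (- (L /\<^sub>R d)) (ftrl_min K R d L) - R (ftrl_min K R d L)"
proof -
  define w where "w = ftrl_min K R d L"
  have "(L w + d * R w) / d \<le> (L y + d * R y) / d"
    using ftrl_min_optimal(2)[of d y L] assms by (intro divide_right_mono) (auto simp: w_def)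
  then show ?thesis
    using assms(1) unfolding blinfun_apply_scaled w_def[symmetric] by (simp add: add_divide_distrib)
qed

text \<open>For positive \<open>d\<close> this is \<open>quadratic_growth\<close> at the functional
  \<open>-L/d\<close>, multiplied by \<open>d\<close>. At \<open>d = 0\<close> only minimality of
  \<open>L w\<close> remains.\<close>

lemma ftrl_min_growth:
  fixes L :: "'v \<Rightarrow>\<^sub>L real"
  assumes "0 \<le> d" "y \<in> K"
  defines "w \<equiv> ftrl_min K R d L"
  shows "L w + d * R w + d * (\<mu> / 2 * (norm (y - w))\<^sup>2) \<le> L y + d * R y"
proof (cases "d = 0")
  case True
  then show ?thesis using ftrl_min_zero(2) assms by simp
next
  case False
  then have "0 < d" using assms by simp
  then have "- (L y / d) - R y + \<mu> / 2 * (norm (y - w))\<^sup>2 \<le> - (L w / d) - R w"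
    using quadratic_growth[OF ftrl_min_optimal(1)[OF assms(1), of L] ftrl_min_maximizes_dual assms(2)]
    unfolding blinfun_apply_scaled w_def by simp
  from mult_left_mono[OF this \<open>0 \<le> d\<close>] show ?thesis
    using \<open>0 < d\<close> by (simp add: algebra_simps)
qed

subsection \<open>The conjugate and its Bregman divergence\<close>

lemma fenchel_conj_eq:
  fixes \<theta> :: "'v \<Rightarrow>\<^sub>L real"
  assumes "w \<in> K" "\<And>y. y \<in> K \<Longrightarrow> \<theta> y - R y \<le> \<theta> w - R w"
  shows "fenchel_conj K R \<theta> = \<theta> w - R w"
  unfolding fenchel_conj_def by (rule cSup_eq_maximum) (use assms in auto)

text \<open>The first-order remainder is nonnegative because \<open>w\<close> competes in the
  supremum at \<open>\<theta> + h\<close>. Comparing with the maximizer \<open>v\<close> there,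
  quadratic growth at \<open>w\<close> and Young's inequality bound it by a multiple of the square
  of \<open>norm h\<close>.\<close>

lemma fenchel_conj_has_derivative:
  fixes \<theta> :: "'v \<Rightarrow>\<^sub>L real"
  assumes w: "w \<in> K" "\<And>y. y \<in> K \<Longrightarrow> \<theta> y - R y \<le> \<theta> w - R w"
  shows "(fenchel_conj K R has_derivative (\<lambda>h. h w)) (at \<theta>)"
proof -
  have bound: "\<bar>fenchel_conj K R (\<theta> + h) - fenchel_conj K R \<theta> - h w\<bar> \<le> (norm h)\<^sup>2 / (2 * \<mu>)" for h
  proof -
    define v where "v = ftrl_min K R 1 (- (\<theta> + h))"
    have v: "v \<in> K" "\<And>y. y \<in> K \<Longrightarrow> (\<theta> + h) y - R y \<le> (\<theta> + h) v - R v"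
      using ftrl_min_optimal[where d = 1 and L = "- (\<theta> + h)"]
      unfolding v_def blinfun.minus_left by force+
    have "h (v - w) \<le> norm h * norm (v - w)"
      using norm_blinfun[of h "v - w"] by auto
    also have "\<dots> \<le> (norm h)\<^sup>2 / (2 * \<mu>) + \<mu> / 2 * (norm (v - w))\<^sup>2"
    proof -
      have "0 \<le> (norm h - \<mu> * norm (v - w))\<^sup>2 / (2 * \<mu>)" using \<mu>_pos by simp
      then show ?thesis
        using \<mu>_pos by (simp add: field_simps power2_eq_square)
    qed
    finally have "h v - h w \<le> (norm h)\<^sup>2 / (2 * \<mu>) + \<mu> / 2 * (norm (v - w))\<^sup>2"
      by (simp add: blinfun.diff_right)
    moreover have "fenchel_conj K R (\<theta> + h) = \<theta> v + h v - R v" "fenchel_conj K R \<theta> = \<theta> w - R w"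
      using fenchel_conj_eq[OF v] fenchel_conj_eq[OF w] by (simp_all add: blinfun.add_left)
    ultimately show ?thesis
      using quadratic_growth[OF w v(1)] v(2)[OF w(1)] \<mu>_pos
      by (simp add: blinfun.add_left abs_le_iff)
  qed
  have "(\<lambda>h. \<bar>fenchel_conj K R (\<theta> + h) - fenchel_conj K R \<theta> - h w\<bar> / norm h) \<midarrow>0\<rightarrow> 0"
  proof (rule Lim_null_comparison)
    \<comment> \<open>At \<open>h = 0\<close> the quotient is 0 by the convention on division, so
      the bound holds there too.\<close>
    have "\<bar>fenchel_conj K R (\<theta> + h) - fenchel_conj K R \<theta> - h w\<bar> / norm h \<le> norm h / (2 * \<mu>)" for h
      using bound[of h] \<mu>_pos
      by (cases "h = 0") (auto simp: field_simps power2_eq_square)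
    then show "\<forall>\<^sub>F h in at 0. norm (\<bar>fenchel_conj K R (\<theta> + h) - fenchel_conj K R \<theta> - h w\<bar> / norm h)
        \<le> norm h / (2 * \<mu>)"
      by (auto intro!: always_eventually)
    show "((\<lambda>h::'v \<Rightarrow>\<^sub>L real. norm h / (2 * \<mu>)) \<longlongrightarrow> 0) (at 0)"
      using \<mu>_pos by (auto intro!: tendsto_eq_intros)
  qed
  then show ?thesis
    unfolding has_derivative_at by (auto intro: blinfun.bounded_linear_left)
qed

text \<open>The gradient at \<open>-L/d\<close> is evaluation at \<open>w\<close>, so the terms in
  \<open>L w\<close> cancel and only values at \<open>L'\<close> and \<open>R\<close>
  survive.\<close>

lemma scaled_bregman_fenchel_conj_pos:
  fixes L L' :: "'v \<Rightarrow>\<^sub>L real"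
  assumes "0 < d"
  defines "w \<equiv> ftrl_min K R d L" and "w' \<equiv> ftrl_min K R d L'"
  shows "d * bregman (fenchel_conj K R) (- (L' /\<^sub>R d)) (- (L /\<^sub>R d))
    = (L' w + d * R w) - (L' w' + d * R w')"
proof -
  have w: "w \<in> K" "w' \<in> K" using ftrl_min_optimal(1) assms by auto
  note max = ftrl_min_maximizes_dual[OF assms(1)]
  have "frechet_derivative (fenchel_conj K R) (at (- (L /\<^sub>R d))) = (\<lambda>h. h w)"
    using frechet_derivative_at[OF fenchel_conj_has_derivative[OF w(1), of "- (L /\<^sub>R d)"]] max[of _ L]
    by (simp add: w_def)
  moreover have "fenchel_conj K R (- (L /\<^sub>R d)) = blinfun_apply (- (L /\<^sub>R d)) w - R w"
    using fenchel_conj_eq[OF w(1), of "- (L /\<^sub>R d)"] max[of _ L] by (simp add: w_def)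
  moreover have "fenchel_conj K R (- (L' /\<^sub>R d)) = blinfun_apply (- (L' /\<^sub>R d)) w' - R w'"
    using fenchel_conj_eq[OF w(2), of "- (L' /\<^sub>R d)"] max[of _ L'] by (simp add: w'_def)
  ultimately have "bregman (fenchel_conj K R) (- (L' /\<^sub>R d)) (- (L /\<^sub>R d))
      = L' w / d + R w - (L' w' / d + R w')"
    unfolding bregman_def by (simp only: blinfun.diff_left blinfun_apply_scaled)
  then show ?thesis
    using assms(1) by (simp add: distrib_left right_diff_distrib)
qed

text \<open>The points at distance at least \<open>e\<close> from \<open>w\<close> that can be regularized minimizers for small
  \<open>a\<close> lie in a compact sublevel set of \<open>R\<close> on which \<open>L\<close> exceeds its minimum by a fixed gap.\<close>

lemma ftrl_min_tendsto:
  fixes L :: "'v \<Rightarrow>\<^sub>L real"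
  shows "((\<lambda>a. ftrl_min K R a L) \<longlongrightarrow> ftrl_min K R 0 L) (at_right 0)"
proof (rule tendstoI)
  fix e :: real assume "e > 0"
  define w where "w = ftrl_min K R 0 L"
  note w = ftrl_min_zero[where L = L, folded w_def]
  \<comment> \<open>If a minimizer \<open>v\<close> for weight \<open>a\<close> is at distance at
    least \<open>e\<close> from \<open>w\<close>, then it lies in \<open>E\<close>: since
    \<open>L w \<le> L v\<close>, the linear terms drop out of the growth inequality and
    \<open>a\<close> cancels.\<close>
  define E where "E = {v\<in>K. R v \<le> R w - \<mu> / 2 * e\<^sup>2}"
  have "compact E"
    unfolding E_def by (rule lower_semicontinuous_on_compact_sublevel[OF R_lsc K_compact])
  have "0 < \<mu> / 2 * e\<^sup>2" using \<mu>_pos \<open>e > 0\<close> by simp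
  \<comment> \<open>Equality would contradict the tie-breaking rule, as \<open>R\<close> is strictly
    smaller on \<open>E\<close> than at \<open>w\<close>.\<close>
  then have gt: "L w < L v" if "v \<in> E" for v
    using that w(3)[of v] by (force simp: E_def)
  obtain m where m: "m > 0" "\<And>v. v \<in> E \<Longrightarrow> L w + m \<le> L v"
  proof (cases "E = {}")
    case True
    then show ?thesis using that[of 1] by auto
  next
    case False
    have "continuous_on E (blinfun_apply L)" by (intro continuous_intros)
    then obtain v where v: "v \<in> E" "\<And>u. u \<in> E \<Longrightarrow> L v \<le> L u"
      using continuous_attains_inf[OF \<open>compact E\<close> False] by blast
    show ?thesis using that[of "L v - L w"] gt[OF v(1)] v(2) by simp
  qed
  \<comment> \<open>Once \<open>a * R w\<close> is below the gap \<open>m\<close>, the saving in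
    penalty cannot pay for the excess of \<open>L\<close> on \<open>E\<close>.\<close>
  have "((\<lambda>a. a * R w) \<longlongrightarrow> 0) (at_right 0)"
    by (auto intro!: tendsto_eq_intros)
  then have "\<forall>\<^sub>F a in at_right 0. a * R w < m"
    using m(1) order_tendstoD by blast
  moreover have "\<forall>\<^sub>F a in at_right 0. a > (0::real)"
    by (simp add: eventually_at_right_less)
  ultimately show "\<forall>\<^sub>F a in at_right 0. dist (ftrl_min K R a L) (ftrl_min K R 0 L) < e"
  proof eventually_elim
    case (elim a)
    define v where "v = ftrl_min K R a L"
    have v: "v \<in> K" "L v + a * R v + a * (\<mu> / 2 * (norm (w - v))\<^sup>2) \<le> L w + a * R w"
      using ftrl_min_optimal(1)[of a L] ftrl_min_growth[of a w L] elim w(1) by (auto simp: v_def)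
    show ?case
    proof (rule ccontr)
      assume "\<not> ?thesis"
      then have "e \<le> norm (w - v)" by (simp add: v_def w_def dist_norm norm_minus_commute)
      then have e2: "\<mu> / 2 * e\<^sup>2 \<le> \<mu> / 2 * (norm (w - v))\<^sup>2"
        using \<open>e > 0\<close> \<mu>_pos by (intro mult_left_mono power_mono) auto
      have "a * (R v + \<mu> / 2 * (norm (w - v))\<^sup>2) \<le> a * R w"
        using v(2) w(2)[OF v(1)] by (simp add: algebra_simps)
      then have "R v + \<mu> / 2 * (norm (w - v))\<^sup>2 \<le> R w" using elim by simp
      then have "v \<in> E" using e2 v(1) by (simp add: E_def)
      have "0 \<le> a * R v" "0 \<le> a * (\<mu> / 2 * (norm (w - v))\<^sup>2)"
        using elim R_nonneg[OF v(1)] \<mu>_pos by auto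
      then have "L v \<le> L w + a * R w" using v(2) by linarith
      then show False using m(2)[OF \<open>v \<in> E\<close>] elim by linarith
    qed
  qed
qed

text \<open>Comparing the two minimizers shows that \<open>R\<close> at the one for
  \<open>a > 0\<close> is at most \<open>R\<close> at the one for 0. Thus \<open>a * R\<close> tends
  to 0 without continuity of \<open>R\<close>.\<close>

lemma ftrl_value_tendsto:
  fixes L L' :: "'v \<Rightarrow>\<^sub>L real"
  shows "((\<lambda>a. L' (ftrl_min K R a L) + a * R (ftrl_min K R a L))
    \<longlongrightarrow> L' (ftrl_min K R 0 L)) (at_right 0)"
proof -
  define w where "w = ftrl_min K R 0 L"
  have le: "R (ftrl_min K R a L) \<le> R w" if "a > 0" for a
  proof -
    have "a * R (ftrl_min K R a L) \<le> a * R w"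
      using ftrl_min_optimal[where d = a and L = L] ftrl_min_zero[where L = L] that
      by (smt (verit, best) w_def)
    then show ?thesis using that by simp
  qed
  have "((\<lambda>a. a * R (ftrl_min K R a L)) \<longlongrightarrow> 0) (at_right 0)"
  proof (rule Lim_null_comparison)
    show "\<forall>\<^sub>F a in at_right 0. norm (a * R (ftrl_min K R a L)) \<le> a * R w"
      unfolding eventually_at_filter
      by (rule always_eventually)
        (auto simp: abs_mult R_nonneg ftrl_min_optimal(1) intro!: mult_left_mono le)
    show "((\<lambda>a. a * R w) \<longlongrightarrow> 0) (at_right 0)"
      by (auto intro!: tendsto_eq_intros)
  qed
  then show ?thesis
    using tendsto_add[OF blinfun.tendsto[OF tendsto_const[of L'] ftrl_min_tendsto]] by fastforce
qed

text \<open>At \<open>d = 0\<close> both regularized values converge, so \<open>Lim\<close> denotes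
  a genuine limit and the formula for positive \<open>d\<close> extends.\<close>

lemma scaled_bregman_fenchel_conj:
  fixes L L' :: "'v \<Rightarrow>\<^sub>L real"
  assumes "0 \<le> d"
  defines "w \<equiv> ftrl_min K R d L" and "w' \<equiv> ftrl_min K R d L'"
  shows "scaled_bregman (fenchel_conj K R) d L' L = (L' w + d * R w) - (L' w' + d * R w')"
proof (cases "d = 0")
  case True
  have "((\<lambda>a. a * bregman (fenchel_conj K R) (- (L' /\<^sub>R a)) (- (L /\<^sub>R a)))
      \<longlongrightarrow> L' (ftrl_min K R 0 L) - L' (ftrl_min K R 0 L')) (at_right 0)"
    by (rule Lim_transform_eventually[OF
          tendsto_diff[OF ftrl_value_tendsto[of L' L] ftrl_value_tendsto[of L' L']]])
      (auto simp: eventually_at_filter scaled_bregman_fenchel_conj_pos intro!: always_eventually)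
  then have "Lim (at_right 0) (\<lambda>a. a * bregman (fenchel_conj K R) (- (L' /\<^sub>R a)) (- (L /\<^sub>R a)))
      = L' (ftrl_min K R 0 L) - L' (ftrl_min K R 0 L')"
    by (intro tendsto_Lim) auto
  then show ?thesis by (simp add: scaled_bregman_def True w_def w'_def)
next
  case False
  then show ?thesis
    using scaled_bregman_fenchel_conj_pos[of d L' L] assms by (simp add: scaled_bregman_def)
qed

end

subsection \<open>Regret of AdaFTRL\<close>

lemma cum_loss_0 [simp]: "cum_loss l 0 = 0"
  by (simp add: cum_loss_def)

lemma cum_loss_Suc: "cum_loss l (Suc t) = cum_loss l t + l (Suc t)"
  by (simp add: cum_loss_def)

lemma adaftrl_Delta_0 [simp]: "adaftrl_Delta K R l 0 = 0"
  by (subst adaftrl_Delta.simps) simp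

lemma adaftrl_Delta_Suc:
  "adaftrl_Delta K R l (Suc t) = adaftrl_Delta K R l t +
     scaled_bregman (fenchel_conj K R) (adaftrl_Delta K R l t) (cum_loss l (Suc t)) (cum_loss l t)"
  by (simp add: adaftrl_Delta.simps[of K R l "Suc t"] adaftrl_Delta.simps[of K R l t])

lemma adaftrl_Suc:
  "adaftrl K R l (Suc t) = ftrl_min K R (adaftrl_Delta K R l t) (cum_loss l t)"
  by (simp add: adaftrl_def ftrl_min_def)

section \<open>Growth of \<open>adaftrl_Delta\<close> and the telescoping regret bound\<close>

context ftrl_regularizer
begin

text \<open>Growth of the objective for \<open>L\<close> at \<open>w\<close> leaves
  \<open>\<delta>\<close> at most \<open>norm h * n\<close> minus a quadratic in \<open>n\<close>,
  the distance between the minimizers. Dropping the quadratic gives the bound by \<open>D\<close>;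
  completing the square gives the one that decays with \<open>d\<close>.\<close>

lemma scaled_bregman_bounds:
  fixes L h :: "'v \<Rightarrow>\<^sub>L real"
  assumes "0 \<le> d" and D: "\<And>x y. x \<in> K \<Longrightarrow> y \<in> K \<Longrightarrow> norm (x - y) \<le> D"
  defines "\<delta> \<equiv> scaled_bregman (fenchel_conj K R) d (L + h) L"
  shows "0 \<le> \<delta>" and "\<delta> \<le> D * norm h" and "2 * d * \<delta> \<le> (norm h)\<^sup>2 / \<mu>"
proof -
  define w where "w = ftrl_min K R d L"
  define w' where "w' = ftrl_min K R d (L + h)"
  have w: "w \<in> K" "w' \<in> K"
    using ftrl_min_optimal(1)[OF assms(1)] by (auto simp: w_def w'_def)
  have \<delta>: "\<delta> = ((L + h) w + d * R w) - ((L + h) w' + d * R w')"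
    using scaled_bregman_fenchel_conj[OF assms(1)] by (simp add: \<delta>_def w_def w'_def)
  show "0 \<le> \<delta>"
    using ftrl_min_optimal(2)[OF assms(1) w(1), of "L + h"] by (simp add: \<delta> w'_def)
  define n where "n = norm (w' - w)"
  have "h w - h w' \<le> norm h * n"
    using norm_blinfun[of h "w - w'"] by (simp add: n_def norm_minus_commute blinfun.diff_right)
  then have up: "\<delta> \<le> norm h * n - d * (\<mu> / 2 * n\<^sup>2)"
    using ftrl_min_growth[OF assms(1) w(2), of L] by (simp add: \<delta> w_def n_def blinfun.add_left)
  have "norm h * n \<le> norm h * D" "0 \<le> d * (\<mu> / 2 * n\<^sup>2)"
    using D[OF w(2,1)] assms(1) \<mu>_pos by (auto simp: n_def intro: mult_left_mono)
  with up show "\<delta> \<le> D * norm h" by (simp add: mult.commute)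
  have "2 * d * \<mu> * \<delta> \<le> 2 * d * \<mu> * (norm h * n - d * (\<mu> / 2 * n\<^sup>2))"
    using up assms(1) \<mu>_pos by (intro mult_left_mono) auto
  also have "\<dots> = (norm h)\<^sup>2 - (norm h - d * \<mu> * n)\<^sup>2"
    by (simp add: algebra_simps power2_eq_square)
  also have "\<dots> \<le> (norm h)\<^sup>2" by simp
  finally show "2 * d * \<delta> \<le> (norm h)\<^sup>2 / \<mu>"
    using \<mu>_pos by (simp add: field_simps)
qed

lemma adaftrl_Delta_nonneg: "0 \<le> adaftrl_Delta K R l t"
proof (induction t)
  case (Suc t)
  \<comment> \<open>The diameter supplies the distance bound that
    \<open>scaled_bregman_bounds\<close> asks for.\<close>
  have "bounded K" using K_compact by (rule compact_imp_bounded)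
  then have "norm (x - y) \<le> diameter K" if "x \<in> K" "y \<in> K" for x y
    using diameter_bounded_bound[of K x y] that by (simp add: dist_norm)
  from scaled_bregman_bounds(1)[OF Suc this] Suc show ?case
    by (simp add: adaftrl_Delta_Suc cum_loss_Suc)
qed simp

text \<open>In the square of \<open>d + \<delta>\<close>, the cross term contributes
  \<open>1 / \<mu>\<close> and the square of \<open>\<delta>\<close> contributes the square of
  \<open>D\<close>.\<close>

lemma adaftrl_Delta_squared_le:
  assumes D: "\<And>x y. x \<in> K \<Longrightarrow> y \<in> K \<Longrightarrow> norm (x - y) \<le> D"
  shows "(adaftrl_Delta K R l T)\<^sup>2 \<le> (D\<^sup>2 + 1 / \<mu>) * (\<Sum>t=1..T. (norm (l t))\<^sup>2)"
proof (induction T)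
  case (Suc T)
  define d where "d = adaftrl_Delta K R l T"
  define \<delta> where "\<delta> = scaled_bregman (fenchel_conj K R) d (cum_loss l T + l (Suc T)) (cum_loss l T)"
  have "0 \<le> d" unfolding d_def by (rule adaftrl_Delta_nonneg)
  note b = scaled_bregman_bounds[OF this D, of "cum_loss l T" "l (Suc T)", folded \<delta>_def]
  have "\<delta>\<^sup>2 \<le> (D * norm (l (Suc T)))\<^sup>2" using b by (intro power_mono) auto
  then have "(d + \<delta>)\<^sup>2 \<le> d\<^sup>2 + (D\<^sup>2 + 1 / \<mu>) * (norm (l (Suc T)))\<^sup>2"
    using b(3) by (simp add: power2_sum power_mult_distrib algebra_simps)
  then show ?case
    using Suc by (simp add: adaftrl_Delta_Suc cum_loss_Suc d_def \<delta>_def algebra_simps)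
qed simp

text \<open>Each increment of \<open>\<Delta>\<close> equals the loss of the prediction minus the increase of the regularized
  minimum, so the regularized minima telescope.\<close>

lemma adaftrl_loss_le:
  assumes u: "u \<in> K"
  shows "(\<Sum>t=1..T. l t (adaftrl K R l t)) \<le> cum_loss l T u + (1 + R u) * adaftrl_Delta K R l T"
proof -
  let ?\<Delta> = "adaftrl_Delta K R l" and ?L = "cum_loss l"
  define \<Phi> where "\<Phi> t = (let w = ftrl_min K R (?\<Delta> t) (?L t) in ?L t w + ?\<Delta> t * R w)" for t
  note nonneg = adaftrl_Delta_nonneg[of l]
  have "(\<Sum>t=1..T. l t (adaftrl K R l t)) \<le> ?\<Delta> T + \<Phi> T"
  proof (induction T)
    case 0
    then show ?case by (simp add: \<Phi>_def)
  next
    case (Suc T)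
    define w where "w = ftrl_min K R (?\<Delta> T) (?L T)"
    define v where "v = ftrl_min K R (?\<Delta> T) (?L (Suc T))"
    define w' where "w' = ftrl_min K R (?\<Delta> (Suc T)) (?L (Suc T))"
    have w': "w' \<in> K" using ftrl_min_optimal(1)[OF nonneg] by (simp add: w'_def)
    have inc: "?\<Delta> (Suc T) - ?\<Delta> T = (?L (Suc T) w + ?\<Delta> T * R w) - (?L (Suc T) v + ?\<Delta> T * R v)"
      using scaled_bregman_fenchel_conj[OF nonneg, of T "?L (Suc T)" "?L T"]
      by (simp add: adaftrl_Delta_Suc w_def v_def)
    have "0 \<le> ?\<Delta> (Suc T) - ?\<Delta> T"
      using ftrl_min_optimal[OF nonneg, where L = "?L (Suc T)"] ftrl_min_optimal(1)[OF nonneg]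
      unfolding inc by (simp add: v_def w_def)
    \<comment> \<open>As \<open>R\<close> is nonnegative, raising the weight cannot lower the
      objective at \<open>w'\<close>, so the new regularized minimum is at least the one attained at
      \<open>v\<close> with the old weight.\<close>
    then have "?\<Delta> T * R w' \<le> ?\<Delta> (Suc T) * R w'"
      using R_nonneg[OF w'] by (intro mult_right_mono) auto
    moreover have "?L (Suc T) v + ?\<Delta> T * R v \<le> ?L (Suc T) w' + ?\<Delta> T * R w'"
      unfolding v_def by (rule ftrl_min_optimal(2)[OF nonneg w'])
    moreover have "\<Phi> (Suc T) = ?L (Suc T) w' + ?\<Delta> (Suc T) * R w'" "\<Phi> T = ?L T w + ?\<Delta> T * R w"
      by (simp_all add: \<Phi>_def w'_def w_def Let_def)
    moreover have "?L (Suc T) w = ?L T w + l (Suc T) w"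
      by (simp add: cum_loss_Suc blinfun.add_left)
    ultimately show ?case using Suc inc by (simp add: adaftrl_Suc flip: w_def)
  qed
  also have "\<Phi> T \<le> ?L T u + ?\<Delta> T * R u"
    using ftrl_min_optimal(2)[OF nonneg u] by (simp add: \<Phi>_def Let_def)
  finally show ?thesis by (simp add: algebra_simps)
qed

theorem adaftrl_regret_le:
  assumes D: "\<And>x y. x \<in> K \<Longrightarrow> y \<in> K \<Longrightarrow> norm (x - y) \<le> D"
    and M: "\<And>u. u \<in> K \<Longrightarrow> R u \<le> M"
  shows "regret K l (adaftrl K R l) T \<le> (1 + M) * sqrt ((D\<^sup>2 + 1 / \<mu>) * (\<Sum>t=1..T. (norm (l t))\<^sup>2))"
  unfolding regret_def
proof (rule cSUP_least[OF K_nonempty])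
  fix u assume u: "u \<in> K"
  let ?\<Delta> = "adaftrl_Delta K R l T"
  have "(\<Sum>t=1..T. l t (adaftrl K R l t)) - (\<Sum>t=1..T. l t u) \<le> (1 + R u) * ?\<Delta>"
    using adaftrl_loss_le[OF u, of l T] by (simp add: cum_loss_def blinfun.sum_left)
  also have "\<dots> \<le> (1 + M) * ?\<Delta>"
    using M[OF u] adaftrl_Delta_nonneg by (intro mult_right_mono) auto
  also have "\<dots> \<le> (1 + M) * sqrt ((D\<^sup>2 + 1 / \<mu>) * (\<Sum>t=1..T. (norm (l t))\<^sup>2))"
    using M[OF u] R_nonneg[OF u] adaftrl_Delta_squared_le[OF D]
    by (intro mult_left_mono real_le_rsqrt) auto
  finally show "(\<Sum>t=1..T. l t (adaftrl K R l t)) - (\<Sum>t=1..T. l t u)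
    \<le> (1 + M) * sqrt ((D\<^sup>2 + 1 / \<mu>) * (\<Sum>t=1..T. (norm (l t))\<^sup>2))" .
qed

text \<open>Growth away from the minimizer \<open>w\<close> of \<open>R\<close> puts
  \<open>K\<close> into a ball around \<open>w\<close> of radius
  \<open>sqrt (2 * M / \<mu>)\<close>; doubling the radius gives the factor 8.\<close>

lemma diameter_le:
  assumes M: "\<And>u. u \<in> K \<Longrightarrow> R u \<le> M" and x: "x \<in> K" and y: "y \<in> K"
  shows "norm (x - y) \<le> sqrt (8 * M / \<mu>)"
proof -
  define w where "w = ftrl_min K R 1 0"
  have w: "w \<in> K" using ftrl_min_optimal(1) by (simp add: w_def)
  have "norm (z - w) \<le> sqrt (2 * M / \<mu>)" if "z \<in> K" for z
  proof -
    have "\<mu> / 2 * (norm (z - w))\<^sup>2 \<le> M"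
      using ftrl_min_growth[of 1 z 0] that M[OF that] R_nonneg[OF w] by (simp add: w_def)
    then have "(norm (z - w))\<^sup>2 \<le> 2 * M / \<mu>" using \<mu>_pos by (simp add: field_simps)
    then show ?thesis by (rule real_le_rsqrt)
  qed
  from this[OF x] this[OF y] have "norm (x - y) \<le> 2 * sqrt (2 * M / \<mu>)"
    using norm_triangle_ineq4[of "x - w" "y - w"] by simp
  also have "\<dots> = sqrt (4 * (2 * M / \<mu>))" unfolding real_sqrt_mult by simp
  finally show ?thesis by simp
qed

end

section \<open>Specialization to the scaled regularizer\<close>

text \<open>A subgradient \<open>g\<close> of \<open>f / c\<close> yields the subgradient
  \<open>c *\<^sub>R g\<close> of \<open>f\<close>.\<close>

lemma strongly_convex_on_divide:
  assumes "strongly_convex_on \<mu> K f" "0 < c"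
  shows "strongly_convex_on (\<mu> / c) K (\<lambda>w. f w / c)"
  unfolding strongly_convex_on_def
proof (intro ballI allI impI)
  fix x y g assume xy: "x \<in> K" "y \<in> K" and g: "is_subgradient K (\<lambda>w. f w / c) x g"
  have "is_subgradient K f x (c *\<^sub>R g)"
    using g \<open>0 < c\<close> unfolding is_subgradient_def
    by (simp add: blinfun.scaleR_left pos_le_divide_eq distrib_right distrib_left mult.commute)
  then have "f y \<ge> f x + c * g (y - x) + \<mu> / 2 * (norm (x - y))\<^sup>2"
    using assms(1) xy by (force simp: strongly_convex_on_def blinfun.scaleR_left)
  from divide_right_mono[OF this, of c] \<open>0 < c\<close>
  show "f y / c \<ge> f x / c + g (y - x) + \<mu> / c / 2 * (norm (x - y))\<^sup>2"
    by (simp add: add_divide_distrib)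
qed

theorem corollary1:
  fixes K :: "'v::real_normed_vector set"
    and f :: "'v \<Rightarrow> real"
    and l :: "nat \<Rightarrow> 'v \<Rightarrow>\<^sub>L real"
    and T :: nat
  assumes finite_dim: "\<exists>B::'v set. finite B \<and> span B = UNIV"
    and K: "K \<noteq> {}" "bounded K" "closed K" "convex K"
    and f_nonneg: "\<And>w. w \<in> K \<Longrightarrow> 0 \<le> f w"
    and f_lsc: "lower_semicontinuous_on K f"
    and f_strong: "strongly_convex_on 1 K f"
    and f_bdd: "bdd_above (f ` K)"
  shows "regret K l (adaftrl K (\<lambda>w. f w / (16 * (SUP v\<in>K. f v))) l) T
           \<le> 5.3 * sqrt ((SUP v\<in>K. f v) * (\<Sum>t=1..T. (norm (l t))\<^sup>2))"
proof -
  define S where "S = (SUP v\<in>K. f v)"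
  define R where "R w = f w / (16 * S)" for w
  let ?\<Sigma> = "\<Sum>t=1..T. (norm (l t))\<^sup>2"
  have f_le: "f w \<le> S" if "w \<in> K" for w
    unfolding S_def using f_bdd that by (rule cSUP_upper2) simp
  have compact: "compact K"
    using finite_dim K finite_span_closed_bounded_imp_compact by blast
  obtain w0 where w0: "w0 \<in> K" using K by blast
  have "0 \<le> S" using f_nonneg[OF w0] f_le[OF w0] by simp
  have "regret K l (adaftrl K R l) T \<le> 5.3 * sqrt (S * ?\<Sigma>)"
  proof (cases "S = 0")
    case True
    \<comment> \<open>Taking \<open>f\<close> itself as regularizer, with upper bound 0, makes the
      diameter bound 0, so \<open>K\<close> is a single point.\<close>
    interpret f: ftrl_regularizer K f 1
      by unfold_locales (use compact K f_nonneg f_lsc f_strong in auto)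
    have single: "x = w0" if "x \<in> K" for x
      using f.diameter_le[of 0 x w0] f_le that w0 True by simp
    \<comment> \<open>Here \<open>R = f / 0\<close> is constantly \<open>0\<close>, which is strongly convex on the singleton \<open>K\<close>.\<close>
    have "strongly_convex_on 1 K R"
      unfolding strongly_convex_on_def
    proof (intro ballI allI impI)
      fix x y and g :: "'v \<Rightarrow>\<^sub>L real" assume "x \<in> K" "y \<in> K"
      then have "x = y" using single by metis
      then show "R y \<ge> R x + g (y - x) + 1 / 2 * (norm (x - y))\<^sup>2" by simp
    qed
    moreover have "lower_semicontinuous_on K R"
      by (simp add: R_def True lower_semicontinuous_on_def)
    ultimately interpret ftrl_regularizer K R 1
      by unfold_locales (use compact K in \<open>auto simp: R_def True\<close>)
    have "adaftrl K R l (Suc t) = w0" for t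
      unfolding adaftrl_Suc using ftrl_min_optimal(1)[OF adaftrl_Delta_nonneg] single by blast
    then have "adaftrl K R l t = w0" if "t \<in> {1..T}" for t
      using that by (cases t) auto
    then have "regret K l (adaftrl K R l) T \<le> 0"
      unfolding regret_def by (intro cSUP_least[OF K(1)]) (simp, metis single order_refl)
    then show ?thesis by (simp add: True)
  next
    case False
    then have "0 < S" using \<open>0 \<le> S\<close> by simp
    interpret ftrl_regularizer K R "1 / (16 * S)"
    proof unfold_locales
      show "strongly_convex_on (1 / (16 * S)) K R"
        unfolding R_def using f_strong \<open>0 < S\<close> by (intro strongly_convex_on_divide) auto
      show "lower_semicontinuous_on K R"
        using lower_semicontinuous_on_cmult[OF f_lsc, of "1 / (16 * S)"] \<open>0 < S\<close>
        by (simp add: R_def[abs_def])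
    qed (use compact K f_nonneg \<open>0 < S\<close> in \<open>auto simp: R_def\<close>)
    have R_le: "R u \<le> 1 / 16" if "u \<in> K" for u
      using f_le[OF that] \<open>0 < S\<close> by (simp add: R_def field_simps)
    \<comment> \<open>Here \<open>M = 1/16\<close> and \<open>\<mu> = 1 / (16 * S)\<close>, so
      \<open>8 * M / \<mu>\<close> equals \<open>8 * S\<close>.\<close>
    have "norm (x - y) \<le> sqrt (8 * S)" if "x \<in> K" "y \<in> K" for x y
      using diameter_le[OF R_le that] \<open>0 < S\<close> by simp
    \<comment> \<open>The factor 24 is \<open>8 + 16\<close>, from the squared diameter and from
      \<open>1 / \<mu>\<close>.\<close>
    from adaftrl_regret_le[OF this R_le]
    have "regret K l (adaftrl K R l) T \<le> (1 + 1 / 16) * sqrt (24 * S * ?\<Sigma>)"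
      using \<open>0 < S\<close> by simp
    also have "\<dots> = (17 / 16 * sqrt 24) * sqrt (S * ?\<Sigma>)"
      by (simp add: real_sqrt_mult)
    also have "\<dots> \<le> 5.3 * sqrt (S * ?\<Sigma>)"
    proof (rule mult_right_mono)
      \<comment> \<open>The square of 4.9 is 24.01, and \<open>17/16 * 4.9\<close> is about
        5.21.\<close>
      have "sqrt 24 \<le> 4.9" by (rule real_le_lsqrt) (auto simp: power2_eq_square)
      then show "17 / 16 * sqrt 24 \<le> 5.3" by simp
      show "0 \<le> sqrt (S * ?\<Sigma>)" using \<open>0 < S\<close> by (simp add: sum_nonneg)
    qed
    finally show ?thesis .
  qed
  then show ?thesis by (simp add: R_def[abs_def] S_def)
qed

end
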